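(* For all integers $n \geq 2$ and $\lambda \geq 1$, $$\mathrm{cap}(n,\lambda) \geq \max\Big\{2\lambda(n-1),\; n\Big[\log n + \Big\lfloor \tfrac{\lambda-1}{2}\Big\rfloor \log\Big(\frac{2\log n}{\lambda-1}\Big)\Big]\Big\},$$ where the term $\lfloor (\lambda-1)/2\rfloor \log(\frac{2\log n}{\lambda-1})$ is interpreted as $0$ when $\lfloor(\lambda-1)/2\rfloor=0$.
   Context: All logarithms are base $2$. For integers $n\ge 2$ and $\lambda\ge 1$, let $K_n^{\lambda}$ be the complete multigraph on vertex set $[n]=\{1,\dots,n\}$ in which every pair of distinct vertices is joined by $\lambda$ parallel edges. A bipartite covering of $K_n^{\lambda}$ is a finite collection $\mathcal H=\{H_1,\dots,H_m\}$ of bipartite graphs, each with vertex set $V(H_i)\subseteq[n]$ (each $H_i$ is a bipartite subgraph of the complete graph on $[n]$), such that every pair of distinct vertices of $[n]$ is an edge of at least $\lambda$ of the graphs $H_i$. The capacity of $\mathcal H$ is $\mathrm{cap}(\mathcal H)=\sum_{i=1}^m |V(H_i)|$. $\mathrm{cap}(n,\lambda)$ denotes the minimum capacity of a bipartite covering of $K_n^{\lambda}$. *)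

theory Defs
  imports Complex_Main "HOL-Library.Multiset"
begin

record 'a ugraph =
  verts :: "'a set"
  edges :: "'a set set"

definition bipartite :: "'a ugraph \<Rightarrow> bool" where
  "bipartite H \<longleftrightarrow>
     (\<exists>A B. A \<union> B = verts H \<and> A \<inter> B = {} \<and>
        (\<forall>e\<in>edges H. \<exists>a\<in>A. \<exists>b\<in>B. e = {a, b}))"

text \<open>
  The members \<open>H\<^sub>1, \<dots>, H\<^sub>m\<close> of a covering need not be distinct, so a covering is a
  multiset of graphs, and repeated graphs count with multiplicity, both for
  the number of times a pair is covered and for the capacity.
\<close>

definition bipartite_covering :: "nat \<Rightarrow> nat \<Rightarrow> nat ugraph multiset \<Rightarrow> bool" where
  "bipartite_covering n l \<H> \<longleftrightarrow>
     (\<forall>H\<in>#\<H>. bipartite H \<and> verts H \<subseteq> {1..n}) \<and>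
     (\<forall>u\<in>{1..n}. \<forall>v\<in>{1..n}. u \<noteq> v \<longrightarrow> l \<le> size {#H \<in># \<H>. {u, v} \<in> edges H#})"

definition capacity :: "'a ugraph multiset \<Rightarrow> nat" where
  "capacity \<H> = (\<Sum>H\<in>#\<H>. card (verts H))"

definition cap :: "nat \<Rightarrow> nat \<Rightarrow> nat" where
  "cap n l = (LEAST c. \<exists>\<H>. bipartite_covering n l \<H> \<and> capacity \<H> = c)"

text \<open>Coverings exist, so the minimum in \<open>cap\<close> is attained.\<close>

lemma bipartite_covering_exists: "\<exists>\<H>. bipartite_covering n l \<H>"
proof -
  define P where "P = {(u, v). u \<in> {1..n} \<and> v \<in> {1..n} \<and> u \<noteq> v}"
  define g :: "nat \<times> nat \<Rightarrow> nat ugraph"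
    where "g = (\<lambda>(u, v). \<lparr>verts = {u, v}, edges = {{u, v}}\<rparr>)"
  define \<H> where "\<H> = repeat_mset l (mset_set (g ` P))"
  have "P \<subseteq> {1..n} \<times> {1..n}"
    by (auto simp: P_def)
  then have fin: "finite (g ` P)"
    by (meson finite_SigmaI finite_atLeastAtMost finite_imageI finite_subset)
  have "bipartite H \<and> verts H \<subseteq> {1..n}" if "H \<in># \<H>" for H
  proof -
    have "H \<in> g ` P"
      using that fin
      by (metis \<H>_def count_mset_set(3) count_repeat_mset mult_0_right not_in_iff)
    then obtain u v where "u \<in> {1..n}" "v \<in> {1..n}" "u \<noteq> v" "H = g (u, v)"
      by (auto simp: P_def)
    moreover from this have "bipartite H"
      unfolding bipartite_def g_def
      by (intro exI[of _ "{u}"] exI[of _ "{v}"]) auto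
    ultimately show ?thesis
      by (simp add: g_def)
  qed
  moreover have "l \<le> size {#H \<in># \<H>. {u, v} \<in> edges H#}"
    if "u \<in> {1..n}" "v \<in> {1..n}" "u \<noteq> v" for u v
  proof -
    have "g (u, v) \<in> g ` P"
      using that by (auto simp: P_def)
    then have "count {#H \<in># \<H>. {u, v} \<in> edges H#} (g (u, v)) = l"
      using fin by (simp add: \<H>_def g_def)
    then show ?thesis
      by (metis count_le_size)
  qed
  ultimately show ?thesis
    unfolding bipartite_covering_def by blast
qed

lemma cap_attained: "\<exists>\<H>. bipartite_covering n l \<H> \<and> capacity \<H> = cap n l"
  unfolding cap_def by (rule LeastI_ex) (use bipartite_covering_exists in blast)

lemma cap_le: "bipartite_covering n l \<H> \<Longrightarrow> cap n l \<le> capacity \<H>"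
  unfolding cap_def by (rule Least_le) blast

end

theory Submission
  imports Defs "HOL-Analysis.Convex" "HOL-Analysis.Harmonic_Numbers"
begin

text \<open>
  Fix a bipartition \<open>(A\<^sub>i, B\<^sub>i)\<close> of every graph of the covering.  The first bound compares
  \<open>|A\<^sub>i| |B\<^sub>i| \<le> n |V(H\<^sub>i)| / 4\<close> with the number \<open>l n (n - 1) / 2\<close> of edges to be covered.
  For the second, a vertex \<open>x\<close> determines a subcube of \<open>{0, 1}\<^sup>m\<close>, of codimension
  its degree \<open>d\<^sub>x\<close> (the number of graphs containing it), and the subcubes of two
  vertices conflict in at least \<open>l\<close> coordinates.  Hence with \<open>k = \<lfloor>(l - 1) / 2\<rfloor>\<close> the points
  at Hamming distance \<open>k\<close> from these subcubes form disjoint sets, which gives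
  \<open>\<Sum>\<^sub>x (d\<^sub>x choose k) / 2^d\<^sub>x \<le> 1\<close>.  Since \<open>(d choose k) \<ge> (d / k)^k\<close> and \<open>t^k / 2^t\<close> is convex on
  \<open>t \<ge> 2 k + 1\<close>, Jensen's inequality bounds the average degree.
\<close>

section \<open>Hamming spheres around subcubes\<close>

text \<open>A set \<open>w\<close> is a point of the cube, \<open>P\<close> and \<open>Q\<close> are
  the coordinates fixed to 1 and to 0, and \<open>(P - w) \<union> (Q \<inter> w)\<close> collects
  the violated ones. Violated coordinates \<open>M\<close> and free part \<open>T\<close> can be
  chosen independently and determine the point.\<close>

lemma card_Hamming_sphere_subcube_ge:
  assumes fin: "finite N" and P: "P \<subseteq> N" and Q: "Q \<subseteq> N" and disj: "P \<inter> Q = {}"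
  shows "(card (P \<union> Q) choose k) * 2 ^ (card N - card (P \<union> Q))
         \<le> card {w \<in> Pow N. card ((P - w) \<union> (Q \<inter> w)) = k}"
proof -
  let ?I = "P \<union> Q"
  let ?S = "{M. M \<subseteq> ?I \<and> card M = k} \<times> Pow (N - ?I)"
  let ?f = "\<lambda>(M, T). T \<union> (P - M) \<union> (Q \<inter> M)"
  have finI: "finite ?I" using fin P Q by (meson finite_subset finite_Un)
  have "inj_on ?f ?S"
  proof (rule inj_on_inverseI[where g = "\<lambda>w. ((P - w) \<union> (Q \<inter> w), w - ?I)"])
    fix z assume "z \<in> ?S"
    then show "(\<lambda>w. ((P - w) \<union> (Q \<inter> w), w - ?I)) (?f z) = z"
      using disj by (cases z) auto
  qed
  moreover have "?f ` ?S \<subseteq> {w \<in> Pow N. card ((P - w) \<union> (Q \<inter> w)) = k}"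
  proof clarify
    fix M T assume M: "M \<subseteq> ?I" and k: "k = card M" and T: "T \<subseteq> N - ?I"
    let ?w = "T \<union> (P - M) \<union> (Q \<inter> M)"
    have "(P - ?w) \<union> (Q \<inter> ?w) = M" using M T disj by auto
    then show "?w \<in> Pow N \<and> card ((P - ?w) \<union> (Q \<inter> ?w)) = card M"
      using M T P Q by auto
  qed
  moreover have "finite {w \<in> Pow N. card ((P - w) \<union> (Q \<inter> w)) = k}"
    using fin by simp
  ultimately have "card ?S \<le> card {w \<in> Pow N. card ((P - w) \<union> (Q \<inter> w)) = k}"
    by (rule card_inj_on_le)
  moreover have "card ?S = (card ?I choose k) * 2 ^ (card N - card ?I)"
    using fin finI P Q by (simp add: card_cartesian_product n_subsets card_Pow card_Diff_subset)
  ultimately show ?thesis by simp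
qed

text \<open>Sphere packing in the cube; for \<open>k = 0\<close> this is a Kraft-type inequality for
  disjoint subcubes.\<close>

lemma sum_choose_div_power_le_1:
  fixes P Q :: "'v \<Rightarrow> 'i set"
  assumes finV: "finite V" and fin: "finite N"
    and sub: "\<And>x. x \<in> V \<Longrightarrow> P x \<subseteq> N \<and> Q x \<subseteq> N \<and> P x \<inter> Q x = {}"
    and far: "\<And>x y. x \<in> V \<Longrightarrow> y \<in> V \<Longrightarrow> x \<noteq> y \<Longrightarrow> 2 * k < card ((P x \<inter> Q y) \<union> (Q x \<inter> P y))"
  shows "(\<Sum>x\<in>V. real (card (P x \<union> Q x) choose k) / 2 ^ card (P x \<union> Q x)) \<le> 1"
proof -
  define E where "E x w = (P x - w) \<union> (Q x \<inter> w)" for x w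
  define S where "S x = {w \<in> Pow N. card (E x w) = k}" for x
  have disj: "S x \<inter> S y = {}" if "x \<in> V" "y \<in> V" "x \<noteq> y" for x y
  proof (rule ccontr)
    assume "S x \<inter> S y \<noteq> {}"
    then obtain w where w: "card (E x w) = k" "card (E y w) = k"
      by (auto simp: S_def)
    have "finite (E x w \<union> E y w)"
      using sub[OF that(1)] sub[OF that(2)] fin by (auto simp: E_def dest: finite_subset)
    \<comment> \<open>Where one subcube demands 1 and the other 0, \<open>w\<close> violates one of
      them; so distance \<open>k\<close> from both leaves room for at most \<open>2 * k\<close>
      conflicts.\<close>
    moreover have "(P x \<inter> Q y) \<union> (Q x \<inter> P y) \<subseteq> E x w \<union> E y w"
      by (auto simp: E_def)
    ultimately have "card ((P x \<inter> Q y) \<union> (Q x \<inter> P y)) \<le> card (E x w \<union> E y w)"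
      by (rule card_mono)
    also have "\<dots> \<le> k + k" using w card_Un_le by metis
    finally show False using far[OF that] by simp
  qed
  have finS: "finite (S x)" for x using fin by (simp add: S_def)
  have "(\<Sum>x\<in>V. card (S x)) = card (\<Union>x\<in>V. S x)"
    using disj finV finS by (simp add: card_UN_disjoint)
  also have "\<dots> \<le> card (Pow N)"
    using fin by (intro card_mono) (auto simp: S_def)
  finally have total: "(\<Sum>x\<in>V. card (S x)) \<le> 2 ^ card N"
    using fin by (simp add: card_Pow)
  have "real (card (P x \<union> Q x) choose k) / 2 ^ card (P x \<union> Q x) \<le> real (card (S x)) / 2 ^ card N"
    if "x \<in> V" for x
  proof -
    let ?d = "card (P x \<union> Q x)"
    \<comment> \<open>This makes the truncated difference \<open>card N - ?d\<close> exact.\<close>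
    have "?d \<le> card N" using sub[OF that] fin by (intro card_mono) auto
    then have split: "(2::real) ^ card N = 2 ^ ?d * 2 ^ (card N - ?d)"
      by (simp flip: power_add)
    have "(?d choose k) * 2 ^ (card N - ?d) \<le> card (S x)"
      unfolding S_def E_def using sub[OF that] fin by (intro card_Hamming_sphere_subcube_ge) auto
    then have "real ((?d choose k) * 2 ^ (card N - ?d)) \<le> real (card (S x))"
      by (rule of_nat_mono)
    then show ?thesis by (simp add: split field_simps)
  qed
  then have "(\<Sum>x\<in>V. real (card (P x \<union> Q x) choose k) / 2 ^ card (P x \<union> Q x))
      \<le> (\<Sum>x\<in>V. real (card (S x)) / 2 ^ card N)"
    by (rule sum_mono)
  also have "\<dots> = real (\<Sum>x\<in>V. card (S x)) / 2 ^ card N"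
    by (simp add: sum_divide_distrib)
  also have "\<dots> \<le> 1"
    using of_nat_mono[OF total, where 'a = real] by simp
  finally show ?thesis .
qed

section \<open>Convexity and Jensen's inequality\<close>

lemma convex_on_eqI:
  assumes "convex_on S f" and eq: "\<And>x. x \<in> S \<Longrightarrow> f x = g x"
  shows "convex_on S g"
proof -
  have S: "convex S" using assms(1) by (rule convex_on_imp_convex)
  then show ?thesis
    using assms(1) by (auto simp: convex_on_def eq[symmetric] convexD)
qed

text \<open>The second derivative is nonnegative from \<open>(k + sqrt k) / ln 2\<close> on. The
  threshold \<open>2 * k + 1\<close> lies beyond that point and is also a lower bound for every
  degree in \<open>capacity_ge_log\<close>.\<close>

lemma convex_on_power_div_exp2:
  "convex_on {2 * real k + 1..} (\<lambda>t. t ^ k / 2 powr t)"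
proof -
  define a where "a = ln (2::real)"
  define g where "g t = exp (real k * ln t - a * t)" for t
  \<comment> \<open>Two terms of the series for \<open>ln 2 = 2 * artanh (1/3)\<close>, namely
    \<open>2/3 + 2/81\<close>.\<close>
  have a: "56 / 81 \<le> a"
    using ln_approx_bounds[of 2 2] by (simp add: eval_nat_numeral a_def)
  have "convex_on {2 * real k + 1..} g"
  proof (rule f''_ge0_imp_convex)
    show "convex {2 * real k + 1..}" by simp
    fix t :: real assume "t \<in> {2 * real k + 1..}"
    then have tk: "2 * real k + 1 \<le> t" by simp
    then have t: "0 < t" by linarith
    show "DERIV g t :> g t * (real k / t - a)"
      unfolding g_def using t by (auto intro!: derivative_eq_intros)
    show "DERIV (\<lambda>t. g t * (real k / t - a)) t :> g t * ((a * t - real k)\<^sup>2 - real k) / t\<^sup>2"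
      unfolding g_def using t
      by (auto intro!: derivative_eq_intros simp: field_simps power2_eq_square)
    \<comment> \<open>The bound on \<open>t\<close> puts \<open>a * t - k\<close> above a
      nonnegative number, so it suffices that the square of this number is at least
      \<open>k\<close>.\<close>
    have "(2 * a - 1) * real k + a \<le> a * t - real k"
      using mult_left_mono[OF tk, of a] a by (simp add: algebra_simps)
    moreover have "0 \<le> (2 * a - 1) * real k + a" using a by simp
    ultimately have "((2 * a - 1) * real k + a)\<^sup>2 \<le> (a * t - real k)\<^sup>2"
      by (rule power_mono)
    \<comment> \<open>AM-GM: the square is at least \<open>4 (2 a - 1) a k\<close>, and \<open>4 (2 a - 1) a \<ge> 1\<close> holds because
      \<open>ln 2\<close> exceeds the root \<open>(1 + sqrt 3) / 4 = 0.683...\<close> (so \<open>ln 2 \<ge> 2/3\<close> would not suffice).\<close>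
    moreover have "4 * ((2 * a - 1) * real k * a) \<le> ((2 * a - 1) * real k + a)\<^sup>2"
      using zero_le_power2[of "(2 * a - 1) * real k - a"]
      by (simp add: power2_eq_square algebra_simps)
    moreover have "1 \<le> 4 * ((2 * a - 1) * a)"
    proof -
      have "(2 * (56/81) - 1) * (56/81) \<le> (2 * a - 1) * a"
        using a by (intro mult_mono) auto
      then show ?thesis by simp
    qed
    then have "real k \<le> 4 * ((2 * a - 1) * real k * a)"
      using mult_right_mono[of 1 "4 * ((2 * a - 1) * a)" "real k"] by (simp add: mult_ac)
    ultimately have "real k \<le> (a * t - real k)\<^sup>2" by linarith
    then show "0 \<le> g t * ((a * t - real k)\<^sup>2 - real k) / t\<^sup>2"
      by (simp add: g_def)
  qed
  moreover have "g t = t ^ k / 2 powr t" if "t \<in> {2 * real k + 1..}" for t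
  proof -
    have "0 < t" using that by (simp add: less_le_trans[of 0 "2 * real k + 1" t])
    then show ?thesis
      by (simp add: g_def a_def exp_diff powr_def exp_of_nat_mult mult.commute)
  qed
  ultimately show ?thesis by (rule convex_on_eqI)
qed

lemma average_ge_if_sum_choose_div_power_le_1:
  fixes d :: "'v \<Rightarrow> nat"
  assumes card_V: "2 \<le> card V"
    and d: "\<And>x. x \<in> V \<Longrightarrow> 2 * k + 1 \<le> d x"
    and le1: "(\<Sum>x\<in>V. real (d x choose k) / 2 ^ d x) \<le> 1"
  defines "D \<equiv> (\<Sum>x\<in>V. real (d x)) / real (card V)"
  shows "log 2 (real (card V)) + (if k = 0 then 0 else real k * log 2 (log 2 (real (card V)) / real k)) \<le> D"
proof -
  define n where "n = real (card V)"
  have n: "2 \<le> n" using card_V by (simp add: n_def)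
  have V: "finite V" "V \<noteq> {}" using card_V by (auto intro: card_ge_0_finite)
  let ?g = "\<lambda>t::real. t ^ k / 2 powr t"
  have "n * (2 * real k + 1) = (\<Sum>x\<in>V. 2 * real k + 1)" by (simp add: n_def)
  also have "\<dots> \<le> (\<Sum>x\<in>V. real (d x))"
    using d by (intro sum_mono) force
  finally have Dk: "2 * real k + 1 \<le> D"
    using n by (simp add: D_def n_def field_simps)
  have "?g (\<Sum>x\<in>V. (1 / n) *\<^sub>R real (d x)) \<le> (\<Sum>x\<in>V. (1 / n) * ?g (real (d x)))"
    using V d n
    by (intro convex_on_sum[OF _ _ convex_on_power_div_exp2[of k]]) (force simp: n_def)+
  then have "?g D \<le> (\<Sum>x\<in>V. ?g (real (d x))) / n"
    by (simp add: D_def n_def sum_divide_distrib mult.commute)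
  moreover have "(\<Sum>x\<in>V. ?g (real (d x))) \<le> real k ^ k"
  proof -
    have "?g (real (d x)) \<le> real k ^ k * (real (d x choose k) / 2 ^ d x)" if "x \<in> V" for x
    proof -
      \<comment> \<open>For \<open>k = 0\<close> both sides are 1, since
        \<open>0 ^ 0 = 1\<close>.\<close>
      have "real (d x) ^ k \<le> real k ^ k * real (d x choose k)"
        using binomial_ge_n_over_k_pow_k[of k "d x", where 'a = real] d[OF that]
        by (cases "k = 0") (simp_all add: power_divide field_simps)
      then show ?thesis by (simp add: powr_realpow divide_right_mono)
    qed
    then have "(\<Sum>x\<in>V. ?g (real (d x))) \<le> (\<Sum>x\<in>V. real k ^ k * (real (d x choose k) / 2 ^ d x))"
      by (rule sum_mono)
    also have "\<dots> = real k ^ k * (\<Sum>x\<in>V. real (d x choose k) / 2 ^ d x)"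
      by (simp add: sum_distrib_left)
    also have "\<dots> \<le> real k ^ k" using le1 by (simp add: mult_left_le)
    finally show ?thesis .
  qed
  ultimately have "?g D \<le> real k ^ k / n"
    using n by (elim order_trans) (intro divide_right_mono, auto)
  then have "n * ?g D \<le> real k ^ k"
    using n by (simp add: pos_le_divide_eq mult.commute)
  then have main: "n * D ^ k \<le> real k ^ k * 2 powr D"
    by (simp add: field_simps)
  show ?thesis
  proof (cases "k = 0")
    case True
    then have "log 2 n \<le> D" using main n by (simp add: log_le_iff)
    then show ?thesis using True by (simp add: n_def)
  next
    case False
    then have k: "0 < real k" by simp
    have D: "0 < D" "1 \<le> D / real k" using Dk k by (auto simp: field_simps)
    have "n * (D / real k) ^ k \<le> 2 powr D"
      using main k by (simp add: power_divide field_simps)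
    moreover have "0 < n * (D / real k) ^ k" using n D k by simp
    ultimately have "log 2 (n * (D / real k) ^ k) \<le> D"
      by (simp add: log_le_iff)
    moreover have "log 2 (n * (D / real k) ^ k) = log 2 n + real k * log 2 (D / real k)"
      using n D k by (simp add: log_mult log_nat_power)
    ultimately have *: "log 2 n + real k * log 2 (D / real k) \<le> D" by simp
    \<comment> \<open>Bootstrapping: as \<open>D \<ge> k\<close>, this term is nonnegative, hence
      \<open>D \<ge> log 2 n\<close>; putting that back under the logarithm in \<open>*\<close>
      removes \<open>D\<close> from the left-hand side.\<close>
    moreover have "0 \<le> real k * log 2 (D / real k)" using D k by simp
    ultimately have nD: "log 2 n \<le> D" by linarith
    have "0 < log 2 n" using n by simp
    then have "log 2 (log 2 n / real k) \<le> log 2 (D / real k)"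
      using nD k D by (simp add: divide_right_mono)
    then have "real k * log 2 (log 2 n / real k) \<le> real k * log 2 (D / real k)"
      using k by simp
    then have "log 2 n + real k * log 2 (log 2 n / real k) \<le> D" using * by linarith
    then show ?thesis using False by (simp add: n_def)
  qed
qed

section \<open>Bipartitions and double counting\<close>

lemma four_mult_card_bipartition_le:
  assumes "finite A" "finite B" "A \<inter> B = {}" "A \<union> B \<subseteq> {1..n::nat}"
  shows "4 * (card A * card B) \<le> n * card (A \<union> B)"
proof -
  have c: "card (A \<union> B) = card A + card B" using assms by (simp add: card_Un_disjoint)
  have "card (A \<union> B) \<le> n" using card_mono[OF _ assms(4)] by simp
  moreover have "4 * (card A * card B) \<le> card (A \<union> B) * card (A \<union> B)"
  proof -
    \<comment> \<open>AM-GM as nonnegativity of a squared difference, over the integers because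
      subtraction of naturals truncates.\<close>
    have "4 * (int (card A) * int (card B)) \<le> (int (card A) + int (card B)) * (int (card A) + int (card B))"
      using zero_le_square[of "int (card A) - int (card B)"] by (simp add: algebra_simps)
    then have "int (4 * (card A * card B)) \<le> int (card (A \<union> B) * card (A \<union> B))"
      by (simp add: c)
    then show ?thesis by (simp only: of_nat_le_iff)
  qed
  ultimately show ?thesis by (meson le_trans mult_le_mono1)
qed

text \<open>Listing the multiset gives repeated graphs distinct indices, so counting indices
  respects multiplicity. Only the two sides of each graph are kept: filling in all edges between
  them preserves the capacity and can only cover more.\<close>

lemma bipartite_covering_bipartitions:
  assumes "bipartite_covering n l \<H>"
  obtains m :: nat and A B :: "nat \<Rightarrow> nat set" where
    "\<And>i. i < m \<Longrightarrow> A i \<inter> B i = {} \<and> A i \<union> B i \<subseteq> {1..n}"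
    "capacity \<H> = (\<Sum>i<m. card (A i \<union> B i))"
    "\<And>x y. x \<in> {1..n} \<Longrightarrow> y \<in> {1..n} \<Longrightarrow> x \<noteq> y \<Longrightarrow>
       l \<le> card {i. i < m \<and> (x \<in> A i \<and> y \<in> B i \<or> x \<in> B i \<and> y \<in> A i)}"
proof -
  obtain Hs where Hs: "\<H> = mset Hs" by (metis ex_mset)
  let ?m = "length Hs"
  have "\<forall>i. \<exists>A B. i < ?m \<longrightarrow> A \<union> B = verts (Hs ! i) \<and> A \<inter> B = {} \<and>
        (\<forall>e\<in>edges (Hs ! i). \<exists>a\<in>A. \<exists>b\<in>B. e = {a, b})"
    using assms by (auto simp: bipartite_covering_def bipartite_def Hs)
  then obtain A B where AB: "\<And>i. i < ?m \<Longrightarrow> A i \<union> B i = verts (Hs ! i) \<and> A i \<inter> B i = {} \<and>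
        (\<forall>e\<in>edges (Hs ! i). \<exists>a\<in>A i. \<exists>b\<in>B i. e = {a, b})"
    by metis
  show ?thesis
  proof (rule that[of ?m A B])
    show "A i \<inter> B i = {} \<and> A i \<union> B i \<subseteq> {1..n}" if "i < ?m" for i
      using AB[OF that] assms that by (auto simp: bipartite_covering_def Hs)
    show "capacity \<H> = (\<Sum>i<?m. card (A i \<union> B i))"
      using AB by (simp add: capacity_def Hs sum_mset_sum_list sum_list_sum_nth atLeast0LessThan flip: mset_map)
    fix x y assume xy: "x \<in> {1..n}" "y \<in> {1..n}" "x \<noteq> y"
    then have "l \<le> size {#H \<in># \<H>. {x, y} \<in> edges H#}"
      using assms by (simp add: bipartite_covering_def)
    also have "\<dots> = card {i. i < ?m \<and> {x, y} \<in> edges (Hs ! i)}"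
      by (simp add: Hs length_filter_conv_card flip: mset_filter)
    also have "\<dots> \<le> card {i. i < ?m \<and> (x \<in> A i \<and> y \<in> B i \<or> x \<in> B i \<and> y \<in> A i)}"
    proof (rule card_mono)
      show "{i. i < ?m \<and> {x, y} \<in> edges (Hs ! i)}
          \<subseteq> {i. i < ?m \<and> (x \<in> A i \<and> y \<in> B i \<or> x \<in> B i \<and> y \<in> A i)}"
      proof clarify
        fix i assume i: "i < ?m" "{x, y} \<in> edges (Hs ! i)" "\<not> (x \<in> B i \<and> y \<in> A i)"
        then obtain a b where ab: "a \<in> A i" "b \<in> B i" "{x, y} = {a, b}"
          using AB[OF i(1)] by metis
        then have "x = a \<and> y = b \<or> x = b \<and> y = a" by (simp add: doubleton_eq_iff)
        then show "x \<in> A i \<and> y \<in> B i" using ab(1,2) i(3) by metis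
      qed
    qed simp
    finally show "l \<le> card {i. i < ?m \<and> (x \<in> A i \<and> y \<in> B i \<or> x \<in> B i \<and> y \<in> A i)}" .
  qed
qed

text \<open>Double counting, applied to graphs against ordered pairs and to graphs against
  vertices.\<close>

lemma sum_card_fibres:
  assumes "finite V" "finite N"
  shows "(\<Sum>x\<in>V. card {i \<in> N. R x i}) = (\<Sum>i\<in>N. card {x \<in> V. R x i})"
  using sum.swap_restrict[OF assms, of "\<lambda>_ _. 1::nat" R] by simp

lemma capacity_ge_edge_count:
  assumes "bipartite_covering n l \<H>" and "0 < n"
  shows "2 * l * (n - 1) \<le> capacity \<H>"
proof -
  obtain m and A B :: "nat \<Rightarrow> nat set" where
    AB: "\<And>i. i < m \<Longrightarrow> A i \<inter> B i = {} \<and> A i \<union> B i \<subseteq> {1..n}" and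
    cap: "capacity \<H> = (\<Sum>i<m. card (A i \<union> B i))" and
    cov: "\<And>x y. x \<in> {1..n} \<Longrightarrow> y \<in> {1..n} \<Longrightarrow> x \<noteq> y \<Longrightarrow>
       l \<le> card {i. i < m \<and> (x \<in> A i \<and> y \<in> B i \<or> x \<in> B i \<and> y \<in> A i)}"
    using bipartite_covering_bipartitions[OF assms(1)] by blast
  \<comment> \<open>Pairs are ordered, so each edge counts twice: there are
    \<open>n * (n - 1)\<close> pairs, and graph \<open>i\<close> covers at most
    \<open>2 * card (A i) * card (B i)\<close> of them.\<close>
  define W where "W = {z \<in> {1..n} \<times> {1..n}. fst z \<noteq> snd z}"
  let ?R = "\<lambda>z i. fst z \<in> A i \<and> snd z \<in> B i \<or> fst z \<in> B i \<and> snd z \<in> A i"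
  have finW: "finite W" by (simp add: W_def)
  have "W = {1..n} \<times> {1..n} - (\<lambda>x. (x, x)) ` {1..n}" by (auto simp: W_def)
  then have "card W = n * n - n"
    by (simp add: card_Diff_subset image_subset_iff card_image inj_on_def card_cartesian_product)
  then have cardW: "card W = n * (n - 1)" by (simp add: algebra_simps)
  have "card W * l \<le> (\<Sum>z\<in>W. card {i \<in> {..<m}. ?R z i})"
    using sum_bounded_below[of W l "\<lambda>z. card {i \<in> {..<m}. ?R z i}"] cov
    by (auto simp: W_def)
  also have "\<dots> = (\<Sum>i<m. card {z \<in> W. ?R z i})"
    using finW by (intro sum_card_fibres) auto
  also have "\<dots> \<le> (\<Sum>i<m. 2 * (card (A i) * card (B i)))"
  proof (rule sum_mono)
    fix i assume "i \<in> {..<m}"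
    then have fin: "finite (A i)" "finite (B i)"
      using AB[of i] by (auto intro: finite_subset)
    then have "card {z \<in> W. ?R z i} \<le> card (A i \<times> B i \<union> B i \<times> A i)"
      by (intro card_mono) auto
    also have "\<dots> \<le> card (A i \<times> B i) + card (B i \<times> A i)" by (rule card_Un_le)
    finally show "card {z \<in> W. ?R z i} \<le> 2 * (card (A i) * card (B i))"
      by (simp add: card_cartesian_product mult.commute)
  qed
  finally have "card W * l \<le> 2 * (\<Sum>i<m. card (A i) * card (B i))"
    by (simp only: sum_distrib_left)
  then have "2 * (card W * l) \<le> 4 * (\<Sum>i<m. card (A i) * card (B i))" by linarith
  also have "\<dots> = (\<Sum>i<m. 4 * (card (A i) * card (B i)))" by (simp only: sum_distrib_left)
  also have "\<dots> \<le> (\<Sum>i<m. n * card (A i \<union> B i))"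
  proof (rule sum_mono)
    fix i assume "i \<in> {..<m}"
    then show "4 * (card (A i) * card (B i)) \<le> n * card (A i \<union> B i)"
      using AB[of i] by (intro four_mult_card_bipartition_le) (auto intro: finite_subset)
  qed
  also have "\<dots> = n * capacity \<H>" by (simp add: cap sum_distrib_left)
  finally have "n * (2 * l * (n - 1)) \<le> n * capacity \<H>"
    by (simp add: cardW mult_ac)
  then show ?thesis using assms(2) by simp
qed

lemma capacity_ge_log:
  assumes "bipartite_covering n l \<H>" and n: "2 \<le> n" and k: "2 * k < l"
  shows "real n * (log 2 (real n) + (if k = 0 then 0 else real k * log 2 (log 2 (real n) / real k)))
         \<le> real (capacity \<H>)"
proof -
  obtain m and A B :: "nat \<Rightarrow> nat set" where
    AB: "\<And>i. i < m \<Longrightarrow> A i \<inter> B i = {} \<and> A i \<union> B i \<subseteq> {1..n}" and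
    cap: "capacity \<H> = (\<Sum>i<m. card (A i \<union> B i))" and
    cov: "\<And>x y. x \<in> {1..n} \<Longrightarrow> y \<in> {1..n} \<Longrightarrow> x \<noteq> y \<Longrightarrow>
       l \<le> card {i. i < m \<and> (x \<in> A i \<and> y \<in> B i \<or> x \<in> B i \<and> y \<in> A i)}"
    using bipartite_covering_bipartitions[OF assms(1)] by blast
  \<comment> \<open>The coordinates are the graph indices; the subcube of \<open>x\<close> is fixed
    to 1 where \<open>x\<close> lies in \<open>A i\<close>, to 0 where it lies in
    \<open>B i\<close>, and free elsewhere.\<close>
  define P where "P x = {i. i < m \<and> x \<in> A i}" for x
  define Q where "Q x = {i. i < m \<and> x \<in> B i}" for x
  define d where "d x = card (P x \<union> Q x)" for x
  have far: "2 * k < card ((P x \<inter> Q y) \<union> (Q x \<inter> P y))"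
    if "x \<in> {1..n}" "y \<in> {1..n}" "x \<noteq> y" for x y
  proof -
    have "{i. i < m \<and> (x \<in> A i \<and> y \<in> B i \<or> x \<in> B i \<and> y \<in> A i)} = (P x \<inter> Q y) \<union> (Q x \<inter> P y)"
      by (auto simp: P_def Q_def)
    then show ?thesis using cov[OF that] k by simp
  qed
  have sub: "P x \<subseteq> {..<m} \<and> Q x \<subseteq> {..<m} \<and> P x \<inter> Q x = {}" for x
    using AB by (auto simp: P_def Q_def)
  have le1: "(\<Sum>x\<in>{1..n}. real (d x choose k) / 2 ^ d x) \<le> 1"
    unfolding d_def by (rule sum_choose_div_power_le_1[where N = "{..<m}"]) (use sub far in auto)
  have d: "2 * k + 1 \<le> d x" if "x \<in> {1..n}" for x
  proof -
    \<comment> \<open>Any second vertex serves: its more than \<open>2 * k\<close> conflicts with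
      \<open>x\<close> all occur in graphs containing \<open>x\<close>.\<close>
    have "(if x = 1 then 2 else 1) \<in> {1..n}" "x \<noteq> (if x = 1 then 2 else 1)" using n by auto
    then obtain y where y: "y \<in> {1..n}" "x \<noteq> y" by blast
    have "2 * k < card ((P x \<inter> Q y) \<union> (Q x \<inter> P y))" by (rule far[OF that y])
    also have "\<dots> \<le> d x"
      unfolding d_def by (intro card_mono) (auto simp: P_def Q_def)
    finally show ?thesis by simp
  qed
  have "(\<Sum>x\<in>{1..n}. d x) = (\<Sum>x\<in>{1..n}. card {i \<in> {..<m}. x \<in> A i \<union> B i})"
    unfolding d_def P_def Q_def by (intro sum.cong arg_cong[of _ _ card]) auto
  also have "\<dots> = (\<Sum>i<m. card {x \<in> {1..n}. x \<in> A i \<union> B i})"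
    by (rule sum_card_fibres) auto
  also have "\<dots> = capacity \<H>"
    unfolding cap using AB by (intro sum.cong arg_cong[of _ _ card]) blast+
  finally have "(\<Sum>x\<in>{1..n}. real (d x)) = real (capacity \<H>)"
    by (metis of_nat_sum)
  moreover have "log 2 (real n) + (if k = 0 then 0 else real k * log 2 (log 2 (real n) / real k))
      \<le> (\<Sum>x\<in>{1..n}. real (d x)) / real n"
    using average_ge_if_sum_choose_div_power_le_1[OF _ d le1] n
    by (simp only: card_atLeastAtMost diff_Suc_1)
  ultimately show ?thesis
    using n by (simp only: pos_le_divide_eq mult.commute of_nat_0_less_iff)
qed

section \<open>Combination of the two bounds\<close>

theorem theorem1p1:
  fixes n l :: nat
  assumes "n \<ge> 2" and "l \<ge> 1"
  shows "real (cap n l) \<ge>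
    max (2 * real l * (real n - 1))
        (real n * (log 2 (real n) +
           (if \<lfloor>(real l - 1) / 2\<rfloor> = 0 then 0
            else real_of_int \<lfloor>(real l - 1) / 2\<rfloor> * log 2 (2 * log 2 (real n) / (real l - 1)))))"
proof -
  obtain \<H> where \<H>: "bipartite_covering n l \<H>" "capacity \<H> = cap n l"
    using cap_attained by blast
  define k where "k = (l - 1) div 2"
  have floor: "\<lfloor>(real l - 1) / 2\<rfloor> = int k"
    using assms floor_divide_of_nat_eq[of "l - 1" 2, where 'a = real]
    by (simp add: k_def of_nat_diff)
  have "2 * real l * (real n - 1) = real (2 * l * (n - 1))"
    using assms by (simp add: of_nat_diff)
  also have "\<dots> \<le> real (cap n l)"
    using capacity_ge_edge_count[OF \<H>(1)] \<H>(2) assms by (intro of_nat_mono) simp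
  finally have 1: "2 * real l * (real n - 1) \<le> real (cap n l)" .
  \<comment> \<open>For odd \<open>l\<close> both sides agree; for even \<open>l\<close>,
    \<open>(l - 1) / 2\<close> exceeds \<open>k\<close> by one half, and the larger denominator only
    lowers the logarithm.\<close>
  have "real k * log 2 (2 * log 2 (real n) / (real l - 1))
      \<le> real k * log 2 (log 2 (real n) / real k)" if "k \<noteq> 0"
  proof -
    have k: "0 < real k" "2 * real k \<le> real l - 1" using that by (auto simp: k_def)
    have pos: "0 < log 2 (real n)" using assms by simp
    have "2 * log 2 (real n) / (real l - 1) \<le> 2 * log 2 (real n) / (2 * real k)"
      using k pos by (intro divide_left_mono) auto
    moreover have "0 < 2 * log 2 (real n) / (real l - 1)" using k pos by simp
    ultimately show ?thesis using k by simp
  qed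
  then have "real n * (log 2 (real n) +
      (if k = 0 then 0 else real k * log 2 (2 * log 2 (real n) / (real l - 1))))
    \<le> real n * (log 2 (real n) + (if k = 0 then 0 else real k * log 2 (log 2 (real n) / real k)))"
    by (intro mult_left_mono) auto
  also have "\<dots> \<le> real (cap n l)"
    using capacity_ge_log[OF \<H>(1), of k] \<H>(2) assms by (simp add: k_def)
  finally show ?thesis using 1 by (auto simp: floor split: if_splits)
qed

end
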